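(* Let $\mathcal{H}$ be a family of finite graphs with lower connective constant $\mu_{\inf}(\mathcal{H})$, and assume $1<\mu_{\inf}(\mathcal{H})<\infty$. Then for every $0<\lambda<\lambda_c(\mu_{\inf}(\mathcal{H}))$ there exists $\delta>0$ (depending on $\lambda$ and $\mathcal{H}$) such that for every $H\in\mathcal{H}$, the partition function $Z_H$ has no zeros in $\mathcal{L}_\delta([0,\lambda])$.
   Context: For a finite graph $G=(V,E)$ and $z\in\mathbb{C}$, the hard-core partition function is $Z_G(z)=\sum_{I}z^{|I|}$, the sum over all independent sets $I$ of $G$. A self-avoiding walk (SAW) of length $i$ starting at $v$ is a walk $v=v_0,v_1,\dots,v_i$ with consecutive vertices adjacent and all $v_j$ distinct. $\mathcal{N}_{\le k}(G,v)$ is the number of SAWs of length $i$ with $1\le i\le k$ starting at $v$, and $\mu_k(G)=\sup_{v\in V}\mathcal{N}_{\le k}(G,v)^{1/k}$. For a family $\mathcal{H}$ of finite graphs, $\mu_k(\mathcal{H})=\sup_{G\in\mathcal{H}}\mu_k(G)$ and the lower connective constant is $\mu_{\inf}(\mathcal{H})=\inf_{k\ge1}\mu_k(\mathcal{H})$. For $x>1$, $\lambda_c(x)=\frac{x^x}{(x-1)^{x+1}}$. For a real interval $I$ and $\delta>0$, $\mathcal{L}_\delta(I)=\{z\in\mathbb{C}: |z-z_0|\le\delta \text{ for some } z_0\in I\}$. *)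

theory Defs
  imports "HOL-Analysis.Analysis"
begin

type_synonym 'a graph = "'a set \<times> ('a \<Rightarrow> 'a \<Rightarrow> bool)"

definition fin_graph :: "'a graph \<Rightarrow> bool" where
  "fin_graph G \<longleftrightarrow> finite (fst G) \<and>
     (\<forall>u v. snd G u v \<longrightarrow> u \<in> fst G \<and> v \<in> fst G \<and> u \<noteq> v \<and> snd G v u)"

definition indep_set :: "'a graph \<Rightarrow> 'a set \<Rightarrow> bool" where
  "indep_set G I \<longleftrightarrow> I \<subseteq> fst G \<and> (\<forall>u\<in>I. \<forall>v\<in>I. \<not> snd G u v)"

definition Z :: "'a graph \<Rightarrow> complex \<Rightarrow> complex" where
  "Z G z = (\<Sum>I\<in>{I. indep_set G I}. z ^ card I)"

definition saw :: "'a graph \<Rightarrow> 'a \<Rightarrow> nat \<Rightarrow> 'a list set" where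
  "saw G v i = {xs. length xs = Suc i \<and> xs ! 0 = v \<and> set xs \<subseteq> fst G \<and> distinct xs \<and>
      (\<forall>j<i. snd G (xs ! j) (xs ! Suc j))}"

definition N_le :: "nat \<Rightarrow> 'a graph \<Rightarrow> 'a \<Rightarrow> nat" where
  "N_le k G v = card (\<Union>i\<in>{1..k}. saw G v i)"

definition mu_k :: "nat \<Rightarrow> 'a graph \<Rightarrow> ereal" where
  "mu_k k G = (SUP v\<in>fst G. ereal (root k (real (N_le k G v))))"

definition mu_k_fam :: "nat \<Rightarrow> 'a graph set \<Rightarrow> ereal" where
  "mu_k_fam k H = (SUP G\<in>H. mu_k k G)"

definition mu_inf :: "'a graph set \<Rightarrow> ereal" where
  "mu_inf H = (INF k\<in>{1..}. mu_k_fam k H)"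

definition lambda_c :: "real \<Rightarrow> real" where
  "lambda_c x = x powr x / (x - 1) powr (x + 1)"

definition L_delta :: "real \<Rightarrow> real set \<Rightarrow> complex set" where
  "L_delta \<delta> I = {z. \<exists>z0\<in>I. cmod (z - complex_of_real z0) \<le> \<delta>}"

end

theory Submission
  imports Defs
begin

text \<open>
  For an induced subgraph \<open>S\<close> and \<open>v \<in> S\<close> let \<open>R(S,v) = z Z(S - N[v]) / Z(S - v)\<close>, so that
  \<open>Z(S) = Z(S - v) (1 + R(S,v))\<close>. Deleting the neighbours of \<open>v\<close> one at a time gives
  \<open>R(S,v) = z \<Prod> 1 / (1 + R(S\<^sub>u,u))\<close> with shrinking \<open>S\<^sub>u \<subseteq> S - v\<close>; the paths of this recursion are
  self-avoiding walks. Linearize around the positive solution \<open>X\<close> at a real point \<open>z\<^sub>0\<close> and measure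
  the deviation as \<open>\<bar>R - X\<bar> / sqrt (X (1 + X))\<close>, that is, weighted by the derivative of
  \<open>2 arsinh (sqrt X)\<close>. With
  \<open>t = X / (1 + X)\<close> one step has the coefficients \<open>sqrt (t t\<^sub>u)\<close>, and Hoelder's inequality with exponents
  \<open>2a, q\<close> together with \<open>t\<^sup>a \<Sum> t\<^sub>u\<^sup>a \<le> m\<^sup>1\<^sup>-\<^sup>2\<^sup>a\<close>, valid for \<open>z\<^sub>0 \<le> lambda_c m\<close>, shows that the \<open>q\<close>-th power
  of the deviation is at most about \<open>1/m\<close> times the sum over the children. If \<open>k\<close> is chosen with
  \<open>mu_k_fam k H < \<mu> < m\<close>, then unrolling \<open>k\<close> levels gives a contraction by about \<open>(\<mu>/m)\<^sup>k\<close>, so a uniform bound on the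
  deviation propagates by induction on \<open>S\<close>. Near \<open>0\<close>, where the linearization
  degenerates, the bounded degree suffices.
\<close>

subsection \<open>An extremal inequality for the hard-core recursion\<close>

text \<open>By convexity, chords of \<open>exp\<close> starting at 0 get steeper. This decides the
  sign of the derivative of \<open>g\<close> below.\<close>

lemma exp_slope_mono:
  fixes x y :: real
  assumes "0 < x" "x \<le> y"
  shows "(exp x - 1) / x \<le> (exp y - 1) / y"
proof -
  have "exp ((1 - x / y) * 0 + (x / y) * y) \<le> (1 - x / y) * exp 0 + (x / y) * exp y"
    using convex_onD[OF exp_convex, of "x / y" 0 y] assms by (simp add: field_simps)
  then have "exp x - 1 \<le> (x / y) * (exp y - 1)"
    using assms by (simp add: algebra_simps)
  then show ?thesis
    using assms by (simp add: field_simps)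
qed

text \<open>The exponent \<open>a\<close> is chosen such that equality holds, with tangency, at \<open>y = Y\<close>.\<close>
lemma powr_one_minus_exp_le:
  fixes m y :: real
  assumes m: "1 < m" and y: "0 < y"
    and Y_def: "Y = ln (m / (m - 1))" and a_def: "a = 1 / ((m - 1) * Y)"
  shows "(1 - exp (- y)) powr a \<le> m powr (- a) * (y / Y)"
proof -
  have Y: "0 < Y" unfolding Y_def using m by simp
  have expY: "exp Y = m / (m - 1)" unfolding Y_def using m by simp
  have a: "0 < a" unfolding a_def using m Y by simp
  have slope: "(exp Y - 1) / Y = a"
    unfolding expY a_def using m Y by (simp add: field_simps)
  \<comment> \<open>The logarithm of \<open>(1 - exp (- y)) powr a / y\<close>. Its derivative is
    nonnegative exactly where \<open>(exp x - 1) / x \<le> a\<close>, and by \<open>slope\<close>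
    this changes at \<open>Y\<close>, so the maximum is there.\<close>
  define g where "g = (\<lambda>y. a * ln (1 - exp (- y)) - ln y)"
  have dg: "(g has_real_derivative (a / (exp x - 1) - 1 / x)) (at x)" if "0 < x" for x
  proof -
    have "exp (-x) / (1 - exp (-x)) = 1 / (exp x - 1)"
      using that by (simp add: exp_minus field_simps)
    then have eq: "a * (exp (-x) / (1 - exp (-x))) - 1 / x = a / (exp x - 1) - 1 / x"
      by simp
    have "(g has_real_derivative (a * (exp (-x) / (1 - exp (-x))) - 1 / x)) (at x)"
      unfolding g_def using that by (auto intro!: derivative_eq_intros)
    then show ?thesis unfolding eq .
  qed
  have "g y \<le> g Y"
  proof (cases "y \<le> Y")
    case True
    show ?thesis
    proof (rule DERIV_nonneg_imp_nondecreasing[OF True])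
      fix x assume x: "y \<le> x" "x \<le> Y"
      have "(exp x - 1) / x \<le> a" using exp_slope_mono[of x Y] x y slope by simp
      then have "0 \<le> a / (exp x - 1) - 1 / x" using x y by (simp add: field_simps)
      then show "\<exists>d. (g has_real_derivative d) (at x) \<and> 0 \<le> d" using dg x y by (meson less_le_trans)
    qed
  next
    case False
    show ?thesis
    proof (rule DERIV_nonpos_imp_nonincreasing[of Y y g])
      show "Y \<le> y" using False by simp
      fix x assume x: "Y \<le> x" "x \<le> y"
      have "a \<le> (exp x - 1) / x" using exp_slope_mono[of Y x] x Y slope by simp
      then have "a / (exp x - 1) - 1 / x \<le> 0" using x Y by (simp add: field_simps)
      then show "\<exists>d. (g has_real_derivative d) (at x) \<and> d \<le> 0" using dg x Y by (meson less_le_trans)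
    qed
  qed
  moreover have "1 - exp (- Y) = 1 / m"
    unfolding exp_minus expY using m by (simp add: field_simps)
  ultimately have "a * ln (1 - exp (- y)) \<le> - a * ln m + ln (y / Y)"
    unfolding g_def using m y Y by (simp add: ln_div)
  then have "exp (a * ln (1 - exp (- y))) \<le> exp (- a * ln m) * exp (ln (y / Y))"
    by (simp flip: exp_add)
  then show ?thesis
    using m y Y by (simp add: powr_def)
qed

text \<open>The same exponent \<open>a\<close> makes the left-hand side maximal at \<open>s = m Y\<close>: at \<open>z = lambda_c m\<close> this is
  the positive fixed point on the \<open>m\<close>-regular tree, where \<open>x / (1 + x) = 1 / m\<close>.\<close>
lemma powr_occupation_le:
  fixes m s x z a Y :: real
  assumes m: "1 < m" and s: "0 \<le> s" and z: "0 < z" "z \<le> lambda_c m"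
    and Y_def: "Y = ln (m / (m - 1))" and a_def: "a = 1 / ((m - 1) * Y)"
    and x_def: "x = z * exp (- s)"
  shows "s * (x / (1 + x)) powr a \<le> (m * Y) * m powr (- a)"
proof -
  have Y: "0 < Y" unfolding Y_def using m by simp
  have a: "0 < a" unfolding a_def using m Y by simp
  define d where "d = s - m * Y"
  \<comment> \<open>For this \<open>w\<close> the first-order terms of
    \<open>exp (- w) + (m - 1) * exp (d - w)\<close> cancel, so \<open>1 + u \<le> exp u\<close>
    bounds it below by exactly \<open>m\<close>.\<close>
  define w where "w = (m - 1) * d / m"
  have x: "0 < x" unfolding x_def using z by simp
  have lc: "lambda_c m = exp (m * Y) / (m - 1)"
    unfolding lambda_c_def Y_def powr_def using m
    by (simp add: ln_div algebra_simps exp_add exp_diff)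
  have "1 / x = exp s / z" unfolding x_def using z by (simp add: exp_minus field_simps)
  also have "\<dots> \<ge> exp s / lambda_c m" using z by (simp add: frac_le)
  also have "exp s / lambda_c m = (m - 1) * exp d"
    unfolding lc d_def exp_diff using m by (simp add: field_simps)
  finally have ge: "1 + 1 / x \<ge> 1 + (m - 1) * exp d" by simp
  have "m = (1 - w) + (m - 1) * (1 + (d - w))"
    unfolding w_def using m by (simp add: field_simps)
  also have "\<dots> \<le> exp (- w) + (m - 1) * exp (d - w)"
    using m exp_ge_add_one_self[of "- w"] exp_ge_add_one_self[of "d - w"]
    by (intro add_mono mult_left_mono) auto
  also have "\<dots> = (1 + (m - 1) * exp d) * exp (- w)"
    by (simp add: exp_diff exp_minus field_simps)
  also have "\<dots> \<le> (1 + 1 / x) * exp (- w)" using ge by (intro mult_right_mono) auto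
  finally have "m * exp w \<le> 1 + 1 / x"
    by (simp add: exp_minus field_simps)
  then have "x / (1 + x) \<le> 1 / (m * exp w)"
    using x m by (simp add: field_simps)
  then have "(x / (1 + x)) powr a \<le> (1 / (m * exp w)) powr a"
    using x a by (intro powr_mono2) auto
  also have "ln (1 / (m * exp w)) = - (ln m + w)"
    using m by (simp add: ln_mult ln_div)
  then have "(1 / (m * exp w)) powr a = m powr (- a) * exp (- (a * w))"
    using m by (simp add: powr_def right_diff_distrib flip: exp_add)
  \<comment> \<open>By the choice of \<open>a\<close> this exponent is
    \<open>s / (m * Y) - 1\<close>, just what \<open>1 + u \<le> exp u\<close> needs to absorb the
    factor \<open>s\<close>.\<close>
  also have "a * w = d / (m * Y)"
    unfolding a_def w_def using m Y by (simp add: field_simps)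
  finally have 1: "(x / (1 + x)) powr a \<le> m powr (- a) * exp (- (d / (m * Y)))" .
  have "s / (m * Y) \<le> exp (d / (m * Y))"
    using exp_ge_add_one_self[of "d / (m * Y)"] m Y unfolding d_def by (simp add: diff_divide_distrib)
  then have "s \<le> (m * Y) * exp (d / (m * Y))" using m Y by (simp add: field_simps)
  then have "s * (x / (1 + x)) powr a \<le>
      ((m * Y) * exp (d / (m * Y))) * (m powr (- a) * exp (- (d / (m * Y))))"
    using 1 s m Y by (intro mult_mono) auto
  also have "\<dots> = (m * Y) * m powr (- a)" by (simp add: exp_minus)
  finally show ?thesis .
qed

text \<open>Writing \<open>1 - t u = exp (- y u)\<close> turns the product into
  \<open>exp (- s)\<close> with \<open>s\<close> the sum of the \<open>y u\<close>. The first
  extremal bound makes each summand linear in \<open>y u\<close>; the second handles what then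
  depends on \<open>s\<close> alone.\<close>

lemma sum_powr_occupation_le:
  fixes m z x a Y :: real and t :: "'b \<Rightarrow> real"
  assumes m: "1 < m" and N: "finite N" and z: "0 < z" "z \<le> lambda_c m"
    and Y_def: "Y = ln (m / (m - 1))" and a_def: "a = 1 / ((m - 1) * Y)"
    and t: "\<And>u. u \<in> N \<Longrightarrow> 0 < t u" "\<And>u. u \<in> N \<Longrightarrow> t u < 1"
    and x_def: "x = z * (\<Prod>u\<in>N. 1 - t u)"
  shows "(x / (1 + x)) powr a * (\<Sum>u\<in>N. t u powr a) \<le> m powr (1 - 2 * a)"
proof -
  have Y: "0 < Y" unfolding Y_def using m by simp
  define y where "y u = - ln (1 - t u)" for u
  define s where "s = (\<Sum>u\<in>N. y u)"
  have y: "0 < y u" "exp (- y u) = 1 - t u" if "u \<in> N" for u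
    unfolding y_def using t[OF that] by auto
  have "exp (- s) = (\<Prod>u\<in>N. 1 - t u)"
    unfolding s_def using y N by (simp add: exp_sum flip: sum_negf)
  then have x: "x = z * exp (- s)" unfolding x_def by simp
  have s: "0 \<le> s" unfolding s_def using y by (intro sum_nonneg) (auto intro: less_imp_le)
  have "(\<Sum>u\<in>N. t u powr a) \<le> (\<Sum>u\<in>N. m powr (- a) * (y u / Y))"
  proof (rule sum_mono)
    fix u assume u: "u \<in> N"
    show "t u powr a \<le> m powr (- a) * (y u / Y)"
      using powr_one_minus_exp_le[OF m y(1)[OF u] Y_def a_def] y(2)[OF u] by simp
  qed
  also have "\<dots> = m powr (- a) / Y * s"
    unfolding s_def by (simp add: sum_distrib_left)
  finally have "(x / (1 + x)) powr a * (\<Sum>u\<in>N. t u powr a) \<le> (x / (1 + x)) powr a * (m powr (- a) / Y * s)"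
    by (intro mult_left_mono) auto
  also have "\<dots> = m powr (- a) / Y * (s * (x / (1 + x)) powr a)" by simp
  also have "\<dots> \<le> m powr (- a) / Y * ((m * Y) * m powr (- a))"
    using powr_occupation_le[OF m s z Y_def a_def x] Y by (intro mult_left_mono) auto
  also have "\<dots> = m powr 1 * m powr (- a) * m powr (- a)" using Y m by simp
  also have "\<dots> = m powr (1 - 2 * a)" by (simp only: powr_add[symmetric]) simp
  finally show ?thesis .
qed

section \<open>Hoelder's inequality and products of perturbed factors\<close>

text \<open>Scale both families to unit power sums and apply Young's inequality termwise.\<close>

lemma Holder_inequality_sum:
  fixes f g :: "'b \<Rightarrow> real" and p q :: real
  assumes pq: "1 < p" "1 < q" "1 / p + 1 / q = 1"
    and f: "\<And>i. i \<in> I \<Longrightarrow> 0 \<le> f i" and g: "\<And>i. i \<in> I \<Longrightarrow> 0 \<le> g i"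
  shows "(\<Sum>i\<in>I. f i * g i) \<le> (\<Sum>i\<in>I. f i powr p) powr (1 / p) * (\<Sum>i\<in>I. g i powr q) powr (1 / q)"
proof (cases "finite I")
  case False
  then show ?thesis by simp
next
  case fin: True
  define F where "F = (\<Sum>i\<in>I. f i powr p)"
  define G where "G = (\<Sum>i\<in>I. g i powr q)"
  have F0: "0 \<le> F" and G0: "0 \<le> G" unfolding F_def G_def by (auto intro: sum_nonneg)
  show ?thesis
  proof (cases "F = 0 \<or> G = 0")
    case True
    then have "\<forall>i\<in>I. f i * g i = 0"
      using fin unfolding F_def G_def by (auto simp: sum_nonneg_eq_0_iff)
    then have "(\<Sum>i\<in>I. f i * g i) = 0" by (intro sum.neutral)
    then show ?thesis by simp
  next
    case False
    then have F: "0 < F" and G: "0 < G" using F0 G0 by auto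
    define A where "A = F powr (1 / p)"
    define B where "B = G powr (1 / q)"
    have A: "0 < A" "A powr p = F" unfolding A_def using F pq by (auto simp: powr_powr)
    have B: "0 < B" "B powr q = G" unfolding B_def using G pq by (auto simp: powr_powr)
    have "(\<Sum>i\<in>I. f i * g i) / (A * B) = (\<Sum>i\<in>I. (f i / A) * (g i / B))"
      by (simp add: sum_divide_distrib)
    also have "\<dots> \<le> (\<Sum>i\<in>I. (f i / A) powr p / p + (g i / B) powr q / q)"
      using f g A B pq by (intro sum_mono Youngs_inequality) auto
    also have "\<dots> = (\<Sum>i\<in>I. f i powr p / F / p + g i powr q / G / q)"
      using f g A B by (intro sum.cong) (auto simp: powr_divide)
    also have "\<dots> = F / F / p + G / G / q"
      by (simp add: sum.distrib F_def[symmetric] G_def[symmetric] flip: sum_divide_distrib)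
    also have "\<dots> = 1" using F G pq by simp
    finally show ?thesis
      using A B unfolding A_def B_def F_def G_def by (simp add: field_simps)
  qed
qed

text \<open>Induction: a further factor turns \<open>P - 1\<close> into
  \<open>(P - 1 - u j) / (1 + u j)\<close>, and \<open>(1 - S) * (1 - b) \<ge> 1 - (b + S)\<close>
  merges the losses. The extreme case is a single factor with negative real
  \<open>u\<close>.\<close>

lemma norm_prod_inverse_minus1_le:
  fixes u :: "'b \<Rightarrow> complex"
  assumes "finite N" "(\<Sum>i\<in>N. cmod (u i)) < 1"
  shows "cmod ((\<Prod>i\<in>N. 1 / (1 + u i)) - 1) \<le> 1 / (1 - (\<Sum>i\<in>N. cmod (u i))) - 1"
  using assms
proof (induction N rule: finite_induct)
  case empty
  then show ?case by simp
next
  case (insert j N)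
  define P where "P = (\<Prod>i\<in>N. 1 / (1 + u i))"
  define S where "S = (\<Sum>i\<in>N. cmod (u i))"
  define b where "b = cmod (u j)"
  have S0: "0 \<le> S" unfolding S_def by (intro sum_nonneg) auto
  have b0: "0 \<le> b" unfolding b_def by simp
  have Sb: "b + S < 1" using insert unfolding S_def b_def by simp
  have IH: "cmod (P - 1) \<le> 1 / (1 - S) - 1"
    using insert.IH Sb b0 unfolding P_def S_def by simp
  have nz: "1 - b \<le> cmod (1 + u j)"
    unfolding b_def using norm_triangle_ineq2[of 1 "- u j"] by simp
  have "1 + u j \<noteq> 0" using nz Sb S0 by auto
  then have "P / (1 + u j) - 1 = (P - 1 - u j) / (1 + u j)" by (simp add: field_simps)
  then have "cmod (P / (1 + u j) - 1) = cmod (P - 1 - u j) / cmod (1 + u j)"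
    by (simp add: norm_divide)
  also have "\<dots> \<le> (1 / (1 - S) - 1 + b) / (1 - b)"
  proof (rule frac_le)
    show "cmod (P - 1 - u j) \<le> 1 / (1 - S) - 1 + b"
      using norm_triangle_ineq4[of "P - 1" "u j"] IH unfolding b_def by simp
    have "0 \<le> 1 / (1 - S) - 1" using Sb S0 b0 by (simp add: field_simps)
    then show "0 \<le> 1 / (1 - S) - 1 + b" using b0 by simp
  qed (use Sb S0 nz in auto)
  also have "\<dots> = 1 / ((1 - S) * (1 - b)) - 1" using Sb S0 b0 by (simp add: divide_simps) argo
  also have "\<dots> \<le> 1 / (1 - (b + S)) - 1"
  proof -
    have "1 - (b + S) \<le> (1 - S) * (1 - b)" using S0 b0 by (simp add: algebra_simps)
    then show ?thesis using Sb by (intro diff_right_mono frac_le) auto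
  qed
  finally show ?case
    using insert unfolding P_def S_def b_def by (simp add: mult.commute)
qed

subsection \<open>One step of the recursion\<close>

text \<open>To first order, the distance in the coordinate \<open>2 arsinh (sqrt x)\<close>. The
  weight is frozen at the real point \<open>x\<close>, so no complex branch of that function
  arises.\<close>

definition weighted_dev :: "real \<Rightarrow> complex \<Rightarrow> real" where
  "weighted_dev x w = cmod (w - complex_of_real x) / sqrt (x * (1 + x))"

lemma weighted_dev_nonneg: "0 < x \<Longrightarrow> 0 \<le> weighted_dev x w"
  unfolding weighted_dev_def by simp

text \<open>The bound on \<open>a\<close> is \<open>ln (1 + h) \<le> h\<close> at
  \<open>h = 1 / (m - 1)\<close>. Hence \<open>2 * a > 1\<close>, and \<open>q\<close> is its
  conjugate exponent.\<close>

lemma Holder_exponents: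
  fixes m Y a q :: real
  assumes m: "1 < m" and Y_def: "Y = ln (m / (m - 1))" and a_def: "a = 1 / ((m - 1) * Y)"
    and q_def: "q = 2 * a / (2 * a - 1)"
  shows "1 \<le> a" and "1 < q"
proof -
  have Y: "0 < Y" unfolding Y_def using m by simp
  have "m / (m - 1) = 1 + 1 / (m - 1)" using m by (simp add: field_simps)
  then have "Y \<le> 1 / (m - 1)" unfolding Y_def using ln_add_one_self_le_self[of "1 / (m - 1)"] m by simp
  then show "1 \<le> a" unfolding a_def using m Y by (simp add: field_simps)
  then show "1 < q" unfolding q_def by (simp add: field_simps)
qed

text \<open>The relative error \<open>v u\<close> of \<open>1 + R u\<close> has modulus
  \<open>sqrt (t u) * e u\<close>, and the parent contributes \<open>sqrt \<tau>\<close>. Hoelder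
  with exponents \<open>2 * a\<close> and \<open>q\<close> and the extremal inequality yield the
  factor \<open>1 / m\<close>. The other losses are the nonlinearity, controlled by
  \<open>\<kappa>\<close>, and the shift from \<open>z0\<close> to \<open>z\<close>, controlled by
  \<open>\<delta> / r\<close>.\<close>

lemma weighted_dev_step:
  fixes X :: "'b \<Rightarrow> real" and R :: "'b \<Rightarrow> complex" and m z0 \<kappa> r \<delta> a q Y x :: real and z w :: complex
  assumes m: "1 < m" and N: "finite N" and z0: "0 < r" "r \<le> z0" "z0 \<le> lambda_c m"
    and z: "cmod (z - complex_of_real z0) \<le> \<delta>"
    and Y_def: "Y = ln (m / (m - 1))" and a_def: "a = 1 / ((m - 1) * Y)"
    and q_def: "q = 2 * a / (2 * a - 1)"
    and \<kappa>: "0 < \<kappa>" "\<kappa> < 1"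
    and X: "\<And>u. u \<in> N \<Longrightarrow> 0 < X u"
    and x_def: "x = z0 * (\<Prod>u\<in>N. 1 / (1 + X u))"
    and w_def: "w = z * (\<Prod>u\<in>N. 1 / (1 + R u))"
    and small: "(\<Sum>u\<in>N. weighted_dev (X u) (R u)) \<le> \<kappa>"
  shows "weighted_dev x w powr q \<le> ((1 + 1 / \<kappa>) / (1 - \<kappa>) * (\<delta> / r)) powr q
      + ((1 + \<kappa>) / (1 - \<kappa>)) powr q / m * (\<Sum>u\<in>N. weighted_dev (X u) (R u) powr q)"
proof -
  have a: "1 \<le> a" and q: "1 < q"
    by (rule Holder_exponents[OF m Y_def a_def q_def])+
  define e where "e u = weighted_dev (X u) (R u)" for u
  define t where "t u = X u / (1 + X u)" for u
  define \<tau> where "\<tau> = x / (1 + x)"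
  define v where "v u = (R u - complex_of_real (X u)) / complex_of_real (1 + X u)" for u
  define S where "S = (\<Sum>u\<in>N. cmod (v u))"
  define b where "b = \<delta> / r"
  have \<delta>: "0 \<le> \<delta>" using z norm_ge_zero order_trans by blast
  have b: "0 \<le> b" unfolding b_def using \<delta> z0 by simp
  have e: "0 \<le> e u" if "u \<in> N" for u
    unfolding e_def by (intro weighted_dev_nonneg X that)
  have t: "0 < t u" "t u < 1" if "u \<in> N" for u
    unfolding t_def using X[OF that] by auto
  have xpos: "0 < x" unfolding x_def using z0 X by (auto intro!: mult_pos_pos prod_pos simp: add_pos_pos)
  have \<tau>: "0 < \<tau>" "\<tau> < 1" unfolding \<tau>_def using xpos by auto
  have sq: "y / sqrt (y * (1 + y)) = sqrt (y / (1 + y))" if "0 < y" for y :: real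
    using that by (simp add: real_sqrt_mult real_sqrt_divide real_div_sqrt flip: divide_divide_eq_left)
  have v: "cmod (v u) = sqrt (t u) * e u" if u: "u \<in> N" for u
  proof -
    have "sqrt (t u) * sqrt (X u * (1 + X u)) = X u"
      unfolding t_def sq[OF X[OF u], symmetric] using X[OF u] by simp
    have "cmod (v u) = cmod (R u - complex_of_real (X u)) / (1 + X u)"
      unfolding v_def norm_divide norm_of_real using X[OF u] by simp
    also have "1 + X u = sqrt (X u * (1 + X u)) / sqrt (t u)"
      unfolding t_def using X[OF u] by (simp add: real_sqrt_mult real_sqrt_divide)
    finally show ?thesis unfolding e_def weighted_dev_def by simp
  qed
  have "cmod (v u) \<le> e u" if "u \<in> N" for u
    unfolding v[OF that] using t[OF that] e[OF that] by (simp add: mult_left_le_one_le)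
  then have "S \<le> \<kappa>"
    using small sum_mono[of N "\<lambda>u. cmod (v u)" e] unfolding S_def e_def by simp
  define P where "P = (\<Prod>u\<in>N. 1 / (1 + v u))"
  have S0: "0 \<le> S" unfolding S_def by (intro sum_nonneg) auto
  have P1: "cmod (P - 1) \<le> 1 / (1 - S) - 1"
    unfolding P_def S_def using \<open>S \<le> \<kappa>\<close> \<kappa>(2) S_def
    by (intro norm_prod_inverse_minus1_le N) simp
  then have P2: "cmod P \<le> 1 / (1 - S)"
    using norm_triangle_sub[of P 1] by simp
  have "1 / (1 + R u) = complex_of_real (1 / (1 + X u)) * (1 / (1 + v u))" if "u \<in> N" for u
  proof -
    have nz: "complex_of_real (1 + X u) \<noteq> 0" using X[OF that] by (simp add: add_pos_pos less_imp_neq [THEN not_sym] del: of_real_add)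
    have "1 + R u = complex_of_real (1 + X u) * (1 + v u)"
      unfolding v_def distrib_left using nz by simp
    then show ?thesis by (simp add: of_real_divide)
  qed
  then have "(\<Prod>u\<in>N. 1 / (1 + R u)) = complex_of_real (\<Prod>u\<in>N. 1 / (1 + X u)) * P"
    unfolding P_def of_real_prod prod.distrib[symmetric] by (intro prod.cong) auto
  then have w: "w = z / complex_of_real z0 * complex_of_real x * P"
    unfolding w_def x_def using z0 by simp
  have "w - complex_of_real x = complex_of_real x * ((P - 1) + (z - complex_of_real z0) / complex_of_real z0 * P)"
    unfolding w using z0 by (simp add: field_simps)
  then have "cmod (w - complex_of_real x) \<le> x * (cmod (P - 1) + cmod (z - complex_of_real z0) / z0 * cmod P)"
    using xpos z0 norm_triangle_ineq[of "P - 1" "(z - complex_of_real z0) / complex_of_real z0 * P"]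
    by (simp add: norm_mult norm_divide)
  also have "\<dots> \<le> x * ((1 / (1 - S) - 1) + b * (1 / (1 - S)))"
    unfolding b_def using xpos z0 P1 P2 \<delta> z \<kappa> \<open>S \<le> \<kappa>\<close>
    by (intro mult_left_mono add_mono mult_mono frac_le) auto
  also have "\<dots> = x * ((S + b) / (1 - S))"
  proof -
    have "1 / (1 - S) - 1 + b * (1 / (1 - S)) = (S + b) / (1 - S)"
      using \<kappa> \<open>S \<le> \<kappa>\<close> by (simp add: divide_simps)
    then show ?thesis by simp
  qed
  also have "\<dots> \<le> x * ((S + b) / (1 - \<kappa>))"
    using \<kappa> \<open>S \<le> \<kappa>\<close> S0 b xpos by (intro mult_left_mono divide_left_mono) auto
  finally have "weighted_dev x w \<le> x * ((S + b) / (1 - \<kappa>)) / sqrt (x * (1 + x))"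
    unfolding weighted_dev_def using xpos by (intro divide_right_mono) auto
  also have "\<dots> = sqrt \<tau> * ((S + b) / (1 - \<kappa>))"
    unfolding \<tau>_def sq[OF xpos, symmetric] by simp
  also have "\<dots> = (sqrt \<tau> * S + sqrt \<tau> * b) / (1 - \<kappa>)" by (simp add: algebra_simps)
  also have "\<dots> \<le> (sqrt \<tau> * S + b) / (1 - \<kappa>)"
    using \<kappa> \<tau> b by (intro divide_right_mono add_left_mono) (auto simp: mult_left_le_one_le)
  finally have dev: "weighted_dev x w \<le> (sqrt \<tau> * S + b) / (1 - \<kappa>)" .
  define T where "T = sqrt \<tau> * S"
  define Q where "Q = (\<Sum>u\<in>N. e u powr q)"
  have T0: "0 \<le> T" unfolding T_def using S0 \<tau> by simp
  have Q0: "0 \<le> Q" unfolding Q_def by (intro sum_nonneg) auto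
  have "T = (\<Sum>u\<in>N. (sqrt \<tau> * sqrt (t u)) * e u)"
    unfolding T_def S_def sum_distrib_left using v by (intro sum.cong) auto
  also have "\<dots> \<le> (\<Sum>u\<in>N. (sqrt \<tau> * sqrt (t u)) powr (2 * a)) powr (1 / (2 * a)) * Q powr (1 / q)"
    unfolding Q_def
  proof (rule Holder_inequality_sum)
    show "1 / (2 * a) + 1 / q = 1" unfolding q_def using a by (simp add: field_simps)
  qed (use a q t \<tau> e in \<open>auto intro: less_imp_le\<close>)
  also have "(\<Sum>u\<in>N. (sqrt \<tau> * sqrt (t u)) powr (2 * a)) = \<tau> powr a * (\<Sum>u\<in>N. t u powr a)"
  proof -
    have "sqrt y powr (2 * a) = y powr a" if "0 \<le> y" for y
      using that by (simp add: powr_half_sqrt[symmetric] powr_powr)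
    then show ?thesis
      unfolding sum_distrib_left using t \<tau> by (intro sum.cong) (auto simp: powr_mult less_imp_le)
  qed
  finally have "T \<le> (\<tau> powr a * (\<Sum>u\<in>N. t u powr a)) powr (1 / (2 * a)) * Q powr (1 / q)" .
  also have "\<dots> \<le> (m powr (1 - 2 * a)) powr (1 / (2 * a)) * Q powr (1 / q)"
  proof (intro mult_right_mono powr_mono2)
    show "\<tau> powr a * (\<Sum>u\<in>N. t u powr a) \<le> m powr (1 - 2 * a)"
      unfolding \<tau>_def
    proof (rule sum_powr_occupation_le[OF m N _ z0(3) Y_def a_def t])
      have "1 / (1 + X u) = 1 - t u" if "u \<in> N" for u
        unfolding t_def using X[OF that] by (simp add: field_simps)
      then show "x = z0 * (\<Prod>u\<in>N. 1 - t u)" unfolding x_def by simp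
    qed (use z0 in auto)
    show "0 \<le> \<tau> powr a * (\<Sum>u\<in>N. t u powr a)" by (intro mult_nonneg_nonneg sum_nonneg) auto
  qed (use a in auto)
  finally have "T powr q \<le> ((m powr (1 - 2 * a)) powr (1 / (2 * a)) * Q powr (1 / q)) powr q"
    using T0 q by (intro powr_mono2) auto
  also have "\<dots> = m powr ((1 - 2 * a) * (1 / (2 * a)) * q) * Q"
    using Q0 q by (simp add: powr_mult powr_powr)
  \<comment> \<open>Conjugacy of \<open>2 * a\<close> and \<open>q\<close> turns the power of
    \<open>m\<close> into exactly \<open>1 / m\<close>.\<close>
  also have "(1 - 2 * a) * (1 / (2 * a)) * q = - 1"
    unfolding q_def using a by (simp add: field_simps)
  finally have Tq: "T powr q \<le> Q / m" using m by (simp add: powr_minus field_simps)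
  define c where "c = 1 / (1 - \<kappa>)"
  have c: "0 < c" unfolding c_def using \<kappa> by simp
  \<comment> \<open>Comparing \<open>b\<close> with \<open>\<kappa> * T\<close> keeps the
    coefficient of \<open>T powr q\<close> near 1, where plain convexity would cost
    \<open>2 powr (q - 1)\<close>. The large factor falls on \<open>b\<close>, which is small with
    \<open>\<delta>\<close>.\<close>
  have "(T + b) powr q \<le> ((1 + 1 / \<kappa>) * b) powr q + ((1 + \<kappa>) * T) powr q"
  proof (cases "b \<le> \<kappa> * T")
    case True
    then have "(T + b) powr q \<le> ((1 + \<kappa>) * T) powr q"
      using T0 b q by (intro powr_mono2) (auto simp: algebra_simps)
    then show ?thesis by (simp add: add_increasing)
  next
    case False
    then have "T + b \<le> (1 + 1 / \<kappa>) * b" using \<kappa> by (simp add: field_simps)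
    then have "(T + b) powr q \<le> ((1 + 1 / \<kappa>) * b) powr q"
      using T0 b q by (intro powr_mono2) auto
    then show ?thesis by (simp add: add_increasing2)
  qed
  also have "((1 + \<kappa>) * T) powr q \<le> (1 + \<kappa>) powr q * (Q / m)"
    unfolding powr_mult using Tq by (intro mult_left_mono) auto
  finally have Tb: "(T + b) powr q \<le> ((1 + 1 / \<kappa>) * b) powr q + (1 + \<kappa>) powr q * (Q / m)"
    by simp
  have "weighted_dev x w powr q \<le> (c * (T + b)) powr q"
    using dev q xpos weighted_dev_nonneg[of x w] unfolding T_def c_def
    by (intro powr_mono2) auto
  also have "\<dots> = c powr q * (T + b) powr q" using c T0 b by (simp add: powr_mult)
  also have "\<dots> \<le> c powr q * (((1 + 1 / \<kappa>) * b) powr q + (1 + \<kappa>) powr q * (Q / m))"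
    using Tb by (intro mult_left_mono) auto
  also have "\<dots> = (c * ((1 + 1 / \<kappa>) * b)) powr q + (c * (1 + \<kappa>)) powr q / m * Q"
    unfolding powr_mult by (simp add: distrib_left)
  finally show "weighted_dev x w powr q \<le> ((1 + 1 / \<kappa>) / (1 - \<kappa>) * (\<delta> / r)) powr q
      + ((1 + \<kappa>) / (1 - \<kappa>)) powr q / m * (\<Sum>u\<in>N. weighted_dev (X u) (R u) powr q)"
    unfolding Q_def e_def b_def c_def by simp
qed

subsection \<open>Independence polynomials and self-avoiding walks\<close>

text \<open>Indexed by vertex sets, so that induced subgraphs share one \<open>E\<close>, and over
  any field, so that real and complex evaluations obey the same identities.\<close>

definition indep_poly :: "('a \<Rightarrow> 'a \<Rightarrow> bool) \<Rightarrow> 'a set \<Rightarrow> 'b::field \<Rightarrow> 'b" where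
  "indep_poly E S z = (\<Sum>I | I \<subseteq> S \<and> (\<forall>u\<in>I. \<forall>v\<in>I. \<not> E u v). z ^ card I)"

text \<open>For a simple graph and \<open>v \<in> S\<close>: the weight of the independent subsets
  of \<open>S\<close> containing \<open>v\<close>, divided by the weight of those avoiding
  \<open>v\<close>.\<close>

definition occ_ratio :: "('a \<Rightarrow> 'a \<Rightarrow> bool) \<Rightarrow> 'b::field \<Rightarrow> 'a set \<Rightarrow> 'a \<Rightarrow> 'b" where
  "occ_ratio E z S v = z * indep_poly E (S - {v} - {u. E v u}) z / indep_poly E (S - {v}) z"

lemma Z_eq_indep_poly: "Z G z = indep_poly (snd G) (fst G) z"
  unfolding Z_def indep_poly_def indep_set_def ..

lemma indep_poly_empty [simp]: "indep_poly E {} z = 1"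
proof -
  have "{I. I \<subseteq> {} \<and> (\<forall>u\<in>I. \<forall>v\<in>I. \<not> E u v)} = {{}}" by auto
  then show ?thesis unfolding indep_poly_def by simp
qed

lemma indep_poly_of_real:
  "indep_poly E S (of_real x :: complex) = of_real (indep_poly E S x)"
  unfolding indep_poly_def by simp

lemma indep_poly_pos:
  fixes x :: real
  assumes "finite S" "0 \<le> x"
  shows "0 < indep_poly E S x"
  unfolding indep_poly_def
  by (rule sum_pos2[where i = "{}"]) (use assms in auto)

lemma occ_ratio_of_real:
  "occ_ratio E (of_real x :: complex) S v = of_real (occ_ratio E x S v)"
  unfolding occ_ratio_def indep_poly_of_real by simp

lemma occ_ratio_pos:
  fixes x :: real
  assumes "finite S" "0 < x"
  shows "0 < occ_ratio E x S v"
  unfolding occ_ratio_def using assms by (simp add: indep_poly_pos)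

text \<open>Split by membership of \<open>v\<close>; removing \<open>v\<close> maps the sets
  containing it bijectively to the independent sets that avoid \<open>v\<close> and its
  neighbours.\<close>

lemma indep_poly_deletion:
  assumes E: "symp E" "irreflp E" and S: "finite S" "v \<in> S"
  shows "indep_poly E S z = indep_poly E (S - {v}) z + z * indep_poly E (S - {v} - {u. E v u}) z"
proof -
  define A where "A T = {I. I \<subseteq> T \<and> (\<forall>u\<in>I. \<forall>v\<in>I. \<not> E u v)}" for T
  define T where "T = S - {v} - {u. E v u}"
  have finA: "finite (A U)" if "finite U" for U unfolding A_def using that by auto
  have eq: "A S = A (S - {v}) \<union> insert v ` A T"
  proof (intro equalityI subsetI)
    fix I assume I: "I \<in> A S"
    show "I \<in> A (S - {v}) \<union> insert v ` A T"
    proof (cases "v \<in> I")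
      case True
      then have "I = insert v (I - {v})" "I - {v} \<in> A T" using I unfolding A_def T_def by auto
      then show ?thesis by blast
    qed (use I in \<open>auto simp: A_def\<close>)
  next
    fix I assume "I \<in> A (S - {v}) \<union> insert v ` A T"
    then show "I \<in> A S"
      using E S unfolding A_def T_def by (auto dest: sympD irreflpD)
  qed
  have vI: "v \<notin> I" "finite I" if "I \<in> A T" for I
    using that S finite_subset[of I S] unfolding A_def T_def by auto
  have "indep_poly E S z = (\<Sum>I\<in>A (S - {v}). z ^ card I) + (\<Sum>I\<in>insert v ` A T. z ^ card I)"
    unfolding indep_poly_def A_def[symmetric] eq using S
    by (intro sum.union_disjoint finA finite_imageI) (auto simp: A_def T_def)
  also have "(\<Sum>I\<in>insert v ` A T. z ^ card I) = (\<Sum>I\<in>A T. z ^ card (insert v I))"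
    by (rule sum.reindex_cong[of "insert v"]) (use vI in \<open>auto simp: inj_on_def insert_ident\<close>)
  also have "\<dots> = z * (\<Sum>I\<in>A T. z ^ card I)"
    unfolding sum_distrib_left using vI by (intro sum.cong) auto
  finally show ?thesis unfolding indep_poly_def A_def T_def .
qed

lemma indep_poly_delete_vertex:
  assumes "symp E" "irreflp E" "finite S" "v \<in> S" "indep_poly E (S - {v}) z \<noteq> 0"
  shows "indep_poly E S z = indep_poly E (S - {v}) z * (1 + occ_ratio E z S v)"
  unfolding occ_ratio_def indep_poly_deletion[OF assms(1-4), of z] using assms(5)
  by (simp add: field_simps)

text \<open>The sets \<open>f u\<close> do not depend on \<open>z\<close>, so that the recursions can be compared at two values of \<open>z\<close>.\<close>
lemma indep_poly_telescope:
  assumes E: "symp E" "irreflp E" and A: "finite A" and S: "finite S" "A \<subseteq> S"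
  shows "\<exists>f. (\<forall>u\<in>A. u \<in> f u \<and> f u \<subseteq> S) \<and>
    (\<forall>z::'b::field. (\<forall>T\<subseteq>S. indep_poly E T z \<noteq> 0) \<longrightarrow>
      indep_poly E S z = indep_poly E (S - A) z * (\<Prod>u\<in>A. 1 + occ_ratio E z (f u) u))"
  using A S(2)
proof (induction A rule: finite_induct)
  case empty
  then show ?case by simp
next
  case (insert a A)
  from insert obtain f where f: "\<forall>u\<in>A. u \<in> f u \<and> f u \<subseteq> S"
    and prod: "\<And>z::'b. (\<forall>T\<subseteq>S. indep_poly E T z \<noteq> 0) \<Longrightarrow>
      indep_poly E S z = indep_poly E (S - A) z * (\<Prod>u\<in>A. 1 + occ_ratio E z (f u) u)"
    by auto
  \<comment> \<open>The vertex \<open>a\<close> is deleted after all of \<open>A\<close>, hence from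
    \<open>S - A\<close>.\<close>
  define g where "g = f(a := S - A)"
  have 1: "\<forall>u\<in>insert a A. u \<in> g u \<and> g u \<subseteq> S"
    using f insert unfolding g_def by auto
  have 2: "indep_poly E S z = indep_poly E (S - insert a A) z * (\<Prod>u\<in>insert a A. 1 + occ_ratio E z (g u) u)"
    if z: "\<forall>T\<subseteq>S. indep_poly E T z \<noteq> 0" for z :: 'b
  proof -
    have del: "S - A - {a} = S - insert a A" by auto
    have "indep_poly E (S - A) z = indep_poly E (S - insert a A) z * (1 + occ_ratio E z (S - A) a)"
      using indep_poly_delete_vertex[OF E, of "S - A" a z] S insert z unfolding del by auto
    moreover have "(\<Prod>u\<in>A. 1 + occ_ratio E z (g u) u) = (\<Prod>u\<in>A. 1 + occ_ratio E z (f u) u)"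
      using insert unfolding g_def by (intro prod.cong) auto
    ultimately show ?thesis
      using prod[OF z] insert by (simp add: g_def mult.assoc)
  qed
  show ?case using 1 2 by blast
qed

text \<open>The ratio compares \<open>S - {v}\<close> with and without the neighbours of
  \<open>v\<close>; telescoping over them gives the product. Each \<open>f u\<close> omits
  \<open>v\<close>, which makes the recursion paths self-avoiding.\<close>

lemma occ_ratio_recursion:
  assumes E: "symp E" "irreflp E" and S: "finite S" "v \<in> S"
  shows "\<exists>f. (\<forall>u\<in>S \<inter> {u. E v u}. u \<in> f u \<and> f u \<subseteq> S - {v}) \<and>
    (\<forall>z::'b::field. (\<forall>T\<subseteq>S - {v}. indep_poly E T z \<noteq> 0) \<longrightarrow>
      occ_ratio E z S v = z * (\<Prod>u\<in>S \<inter> {u. E v u}. 1 / (1 + occ_ratio E z (f u) u)))"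
proof -
  define A where "A = S \<inter> {u. E v u}"
  have A: "finite A" "A \<subseteq> S - {v}" "S - {v} - A = S - {v} - {u. E v u}"
    using S E unfolding A_def by (auto dest: irreflpD)
  obtain f where f: "\<forall>u\<in>A. u \<in> f u \<and> f u \<subseteq> S - {v}"
    and prod: "\<And>z::'b. (\<forall>T\<subseteq>S - {v}. indep_poly E T z \<noteq> 0) \<Longrightarrow>
      indep_poly E (S - {v}) z = indep_poly E (S - {v} - A) z * (\<Prod>u\<in>A. 1 + occ_ratio E z (f u) u)"
    using indep_poly_telescope[OF E A(1) _ A(2), where ?'b = 'b] S by auto
  have "occ_ratio E z S v = z * (\<Prod>u\<in>A. 1 / (1 + occ_ratio E z (f u) u))"
    if z: "\<forall>T\<subseteq>S - {v}. indep_poly E T z \<noteq> 0" for z :: 'b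
  proof -
    have nz: "indep_poly E (S - {v} - A) z \<noteq> 0" using z by auto
    show ?thesis
      unfolding occ_ratio_def[of E z S v] A(3)[symmetric]
      using prod[of z] z nz by (simp add: prod_dividef)
  qed
  then show ?thesis using f unfolding A_def by blast
qed

text \<open>The real recursion is the complex one evaluated at \<open>complex_of_real z0\<close>,
  where positivity rules out zeros, so both run along the same sets \<open>f u\<close>.\<close>

lemma occ_ratio_recursion_real_complex:
  fixes z :: complex and z0 :: real
  assumes E: "symp E" "irreflp E" and S: "finite S" "v \<in> S" and z0: "0 < z0"
    and z: "\<forall>T\<subseteq>S - {v}. indep_poly E T z \<noteq> 0"
  shows "\<exists>f. (\<forall>u\<in>S \<inter> {u. E v u}. u \<in> f u \<and> f u \<subseteq> S - {v}) \<and>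
    occ_ratio E z S v = z * (\<Prod>u\<in>S \<inter> {u. E v u}. 1 / (1 + occ_ratio E z (f u) u)) \<and>
    occ_ratio E z0 S v = z0 * (\<Prod>u\<in>S \<inter> {u. E v u}. 1 / (1 + occ_ratio E z0 (f u) u))"
proof -
  obtain f where f: "\<forall>u\<in>S \<inter> {u. E v u}. u \<in> f u \<and> f u \<subseteq> S - {v}"
    and rec: "\<And>z::complex. \<forall>T\<subseteq>S - {v}. indep_poly E T z \<noteq> 0 \<Longrightarrow>
      occ_ratio E z S v = z * (\<Prod>u\<in>S \<inter> {u. E v u}. 1 / (1 + occ_ratio E z (f u) u))"
    using occ_ratio_recursion[OF E S, where ?'b = complex] by blast
  have "indep_poly E T (complex_of_real z0) \<noteq> 0" if "T \<subseteq> S - {v}" for T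
    using indep_poly_pos[of T z0 E] finite_subset[OF that] S z0
    unfolding indep_poly_of_real by simp
  then have "complex_of_real (occ_ratio E z0 S v) =
      complex_of_real (z0 * (\<Prod>u\<in>S \<inter> {u. E v u}. 1 / (1 + occ_ratio E z0 (f u) u)))"
    using rec[of "complex_of_real z0"] by (simp add: occ_ratio_of_real)
  then have "occ_ratio E z0 S v = z0 * (\<Prod>u\<in>S \<inter> {u. E v u}. 1 / (1 + occ_ratio E z0 (f u) u))"
    unfolding of_real_eq_iff .
  with f rec[OF z] show ?thesis by (intro exI[of _ f] conjI)
qed

section \<open>Self-avoiding walks and the unrolled recursion\<close>

lemma finite_saw:
  assumes "finite S" shows "finite (saw (S, E) v i)"
proof -
  have "saw (S, E) v i \<subseteq> {xs. set xs \<subseteq> S \<and> length xs = Suc i}" unfolding saw_def by auto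
  then show ?thesis using finite_lists_length_eq[OF assms] finite_subset by blast
qed

lemma card_saw_mono:
  assumes "finite S" "T \<subseteq> S" shows "card (saw (T, E) v i) \<le> card (saw (S, E) v i)"
  by (intro card_mono finite_saw assms(1)) (use assms in \<open>auto simp: saw_def\<close>)

lemma card_saw_0: "v \<in> S \<Longrightarrow> card (saw (S, E) v 0) = 1"
proof -
  assume "v \<in> S"
  then have "saw (S, E) v 0 = {[v]}" unfolding saw_def by (auto simp: length_Suc_conv)
  then show ?thesis by simp
qed

text \<open>Prepending \<open>v\<close> is injective on walks avoiding \<open>v\<close>, and walks
  with different first vertices are distinct.\<close>

lemma sum_card_saw_le:
  assumes S: "finite S" "v \<in> S"
  shows "(\<Sum>u\<in>S \<inter> {u. E v u}. card (saw (S - {v}, E) u i)) \<le> card (saw (S, E) v (Suc i))"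
proof -
  define A where "A = S \<inter> {u. E v u}"
  have "(\<Sum>u\<in>A. card (saw (S - {v}, E) u i)) = card (\<Union>u\<in>A. saw (S - {v}, E) u i)"
  proof (rule card_UN_disjoint[symmetric])
    show "\<forall>u\<in>A. finite (saw (S - {v}, E) u i)" using S by (simp add: finite_saw)
  qed (use S in \<open>auto simp: A_def saw_def\<close>)
  also have "\<dots> = card (Cons v ` (\<Union>u\<in>A. saw (S - {v}, E) u i))"
    by (intro card_image[symmetric]) auto
  also have "\<dots> \<le> card (saw (S, E) v (Suc i))"
  proof (intro card_mono finite_saw S(1) subsetI)
    fix xs assume "xs \<in> Cons v ` (\<Union>u\<in>A. saw (S - {v}, E) u i)"
    then obtain u ys where u: "u \<in> A" and ys: "ys \<in> saw (S - {v}, E) u i" and xs: "xs = v # ys" by auto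
    have "E ((v # ys) ! j) ((v # ys) ! Suc j)" if "j < Suc i" for j
      using that u ys unfolding A_def saw_def by (cases j) auto
    then show "xs \<in> saw (S, E) v (Suc i)"
      using u ys S unfolding xs saw_def by auto
  qed
  finally show ?thesis unfolding A_def .
qed

text \<open>Each step removes the current vertex, so level \<open>i\<close> has at most as many
  nodes as there are self-avoiding walks of length \<open>i\<close>. \<open>M\<close> bounds
  \<open>W\<close> on proper subsets only, so at least one level is unrolled when
  \<open>T = S\<close>.\<close>

lemma recursion_unroll:
  fixes W :: "'a set \<Rightarrow> 'a \<Rightarrow> real"
  assumes S: "finite S" and K: "0 \<le> K" "0 \<le> \<rho>" "0 \<le> M"
    and step: "\<And>T v. T \<subseteq> S \<Longrightarrow> v \<in> T \<Longrightarrow> \<exists>f. (\<forall>u\<in>T \<inter> {u. E v u}. u \<in> f u \<and> f u \<subseteq> T - {v}) \<and>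
        W T v \<le> K + \<rho> * (\<Sum>u\<in>T \<inter> {u. E v u}. W (f u) u)"
    and base: "\<And>T v. T \<subset> S \<Longrightarrow> v \<in> T \<Longrightarrow> W T v \<le> M"
    and "T \<subseteq> S" "v \<in> T" "j = 0 \<Longrightarrow> T \<noteq> S"
  shows "W T v \<le> K * (\<Sum>i<j. \<rho> ^ i * card (saw (T, E) v i)) + \<rho> ^ j * card (saw (T, E) v j) * M"
  using assms(7-9)
proof (induction j arbitrary: T v)
  case 0
  then show ?case using base[of T v] by (simp add: card_saw_0 psubset_eq)
next
  case (Suc j)
  define A where "A = T \<inter> {u. E v u}"
  obtain f where f: "\<forall>u\<in>A. u \<in> f u \<and> f u \<subseteq> T - {v}"
    and W: "W T v \<le> K + \<rho> * (\<Sum>u\<in>A. W (f u) u)"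
    using step[OF Suc.prems(1,2)] unfolding A_def by auto
  have T: "finite T" using Suc.prems S finite_subset by auto
  define c where "c U u i = real (card (saw (U, E) u i))" for U u i
  have c: "(\<Sum>u\<in>A. c (f u) u i) \<le> c T v (Suc i)" for i
  proof -
    have "(\<Sum>u\<in>A. c (f u) u i) \<le> (\<Sum>u\<in>A. c (T - {v}) u i)"
      unfolding c_def using f T by (intro sum_mono of_nat_mono card_saw_mono) auto
    also have "\<dots> \<le> c T v (Suc i)"
      unfolding c_def A_def of_nat_sum[symmetric]
      using sum_card_saw_le[OF T Suc.prems(2)] by (intro of_nat_mono)
    finally show ?thesis .
  qed
  have "(\<Sum>u\<in>A. W (f u) u) \<le> (\<Sum>u\<in>A. K * (\<Sum>i<j. \<rho> ^ i * c (f u) u i) + \<rho> ^ j * c (f u) u j * M)"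
  proof (rule sum_mono)
    fix u assume u: "u \<in> A"
    \<comment> \<open>Dropping \<open>v\<close> makes \<open>f u\<close> a proper subset of
      \<open>S\<close>, so the induction hypothesis applies even for \<open>j = 0\<close>.\<close>
    then have "f u \<subseteq> S" "u \<in> f u" "f u \<noteq> S" using f Suc.prems by auto
    then show "W (f u) u \<le> K * (\<Sum>i<j. \<rho> ^ i * c (f u) u i) + \<rho> ^ j * c (f u) u j * M"
      unfolding c_def by (rule Suc.IH)
  qed
  also have "\<dots> = K * (\<Sum>i<j. \<rho> ^ i * (\<Sum>u\<in>A. c (f u) u i)) + \<rho> ^ j * (\<Sum>u\<in>A. c (f u) u j) * M"
  proof -
    have "(\<Sum>u\<in>A. \<Sum>i<j. \<rho> ^ i * c (f u) u i) = (\<Sum>i<j. \<rho> ^ i * (\<Sum>u\<in>A. c (f u) u i))"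
      unfolding sum_distrib_left by (rule sum.swap)
    then show ?thesis
      by (simp only: sum.distrib sum_distrib_left[symmetric] sum_distrib_right[symmetric])
  qed
  also have "\<dots> \<le> K * (\<Sum>i<j. \<rho> ^ i * c T v (Suc i)) + \<rho> ^ j * c T v (Suc j) * M"
    using K c by (intro add_mono mult_left_mono mult_right_mono sum_mono) auto
  finally have "W T v \<le> K + \<rho> * (K * (\<Sum>i<j. \<rho> ^ i * c T v (Suc i)) + \<rho> ^ j * c T v (Suc j) * M)"
    using W K mult_left_mono[of _ _ \<rho>] by fastforce
  also have "\<dots> = K * (\<Sum>i<Suc j. \<rho> ^ i * c T v i) + \<rho> ^ Suc j * c T v (Suc j) * M"
  proof -
    \<comment> \<open>The trivial walk accounts for the new summand \<open>K\<close> once the index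
      is shifted.\<close>
    have "c T v 0 = 1" unfolding c_def using card_saw_0[OF Suc.prems(2)] by simp
    then have "(\<Sum>i<Suc j. \<rho> ^ i * c T v i) = 1 + \<rho> * (\<Sum>i<j. \<rho> ^ i * c T v (Suc i))"
      unfolding sum.lessThan_Suc_shift by (simp add: sum_distrib_left mult.assoc)
    then show ?thesis by (simp add: algebra_simps)
  qed
  finally show ?case unfolding c_def .
qed

subsection \<open>Absence of zeros\<close>

text \<open>Induction keeps every ratio at modulus at most 1/2: each factor of the recursion is then
  at most 2, and at most \<open>D\<close> of them occur. In particular no ratio is -1.\<close>

lemma indep_poly_nonzero_small:
  fixes z :: complex
  assumes E: "symp E" "irreflp E" and V: "finite V"
    and deg: "\<And>S v. S \<subseteq> V \<Longrightarrow> v \<in> S \<Longrightarrow> card (S \<inter> {u. E v u}) \<le> D"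
    and z: "cmod z * 2 ^ D \<le> 1 / 2"
  shows "indep_poly E V z \<noteq> 0"
proof -
  have "indep_poly E S z \<noteq> 0 \<and> (\<forall>v\<in>S. cmod (occ_ratio E z S v) \<le> 1 / 2)"
    if "finite S" "S \<subseteq> V" for S
    using that
  proof (induction S rule: finite_psubset_induct)
    case (psubset S)
    have ratio: "cmod (occ_ratio E z S v) \<le> 1 / 2" if v: "v \<in> S" for v
    proof -
      define A where "A = S \<inter> {u. E v u}"
      have IH: "indep_poly E T z \<noteq> 0" "\<And>u. u \<in> T \<Longrightarrow> cmod (occ_ratio E z T u) \<le> 1 / 2"
        if "T \<subseteq> S - {v}" for T
        using psubset.IH[of T] psubset.prems v that by auto
      obtain f where f: "\<forall>u\<in>A. u \<in> f u \<and> f u \<subseteq> S - {v}"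
        and rec: "\<forall>z::complex. (\<forall>T\<subseteq>S - {v}. indep_poly E T z \<noteq> 0) \<longrightarrow>
          occ_ratio E z S v = z * (\<Prod>u\<in>A. 1 / (1 + occ_ratio E z (f u) u))"
        using occ_ratio_recursion[OF E psubset(1) v] unfolding A_def by (elim exE conjE)
      have rec: "occ_ratio E z S v = z * (\<Prod>u\<in>A. 1 / (1 + occ_ratio E z (f u) u))"
        using rec IH(1) by simp
      have "cmod (1 / (1 + occ_ratio E z (f u) u)) \<le> 2" if u: "u \<in> A" for u
      proof -
        have "cmod (occ_ratio E z (f u) u) \<le> 1 / 2"
          using IH(2) f u by blast
        then have "1 / 2 \<le> cmod (1 + occ_ratio E z (f u) u)"
          using norm_triangle_ineq2[of 1 "- occ_ratio E z (f u) u"] by simp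
        then have "inverse (cmod (1 + occ_ratio E z (f u) u)) \<le> inverse (1 / 2)"
          by (rule le_imp_inverse_le) simp
        then show ?thesis by (simp add: norm_divide inverse_eq_divide)
      qed
      then have "(\<Prod>u\<in>A. cmod (1 / (1 + occ_ratio E z (f u) u))) \<le> (\<Prod>u\<in>A. 2)"
        by (intro prod_mono) auto
      also have "\<dots> \<le> 2 ^ D"
        unfolding prod_constant using deg[OF psubset(3) v] unfolding A_def by (intro power_increasing) auto
      finally have "cmod (occ_ratio E z S v) \<le> cmod z * 2 ^ D"
        unfolding rec norm_mult prod_norm[symmetric] by (intro mult_left_mono) auto
      then show ?thesis using z by simp
    qed
    have "indep_poly E S z \<noteq> 0"
    proof (cases "S = {}")
      case False
      then obtain v where v: "v \<in> S" by auto
      then have "indep_poly E (S - {v}) z \<noteq> 0"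
        using psubset.IH[of "S - {v}"] psubset.prems by auto
      moreover have "1 + occ_ratio E z S v \<noteq> 0"
        using ratio[OF v] norm_triangle_ineq2[of 1 "- occ_ratio E z S v"] by auto
      ultimately show ?thesis
        using indep_poly_delete_vertex[OF E psubset(1) v, of z] by simp
    qed simp
    then show ?case using ratio by blast
  qed
  then show ?thesis using V by blast
qed

text \<open>Induction over subsets maintains nonvanishing together with deviations at most
  \<open>\<eta>\<close>: unrolling \<open>k\<close> levels and applying \<open>contr\<close>
  reproduces the bound, and \<open>\<eta> < 1\<close> keeps the ratio away from -1.\<close>

lemma indep_poly_nonzero_near_positive:
  fixes z :: complex and m z0 \<kappa> r \<delta> a q Y \<rho> \<eta> K B :: real
  assumes E: "symp E" "irreflp E" and V: "finite V"
    and deg: "\<And>S v. S \<subseteq> V \<Longrightarrow> v \<in> S \<Longrightarrow> card (S \<inter> {u. E v u}) \<le> D"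
    and m: "1 < m" and z0: "0 < r" "r \<le> z0" "z0 \<le> lambda_c m"
    and z: "cmod (z - complex_of_real z0) \<le> \<delta>"
    and Y_def: "Y = ln (m / (m - 1))" and a_def: "a = 1 / ((m - 1) * Y)"
    and q_def: "q = 2 * a / (2 * a - 1)"
    and \<kappa>: "0 < \<kappa>" "\<kappa> < 1" and \<rho>: "((1 + \<kappa>) / (1 - \<kappa>)) powr q / m \<le> \<rho>"
    and \<eta>: "0 < \<eta>" "\<eta> < 1" "real D * \<eta> \<le> \<kappa>"
    and K_def: "K = ((1 + 1 / \<kappa>) / (1 - \<kappa>) * (\<delta> / r)) powr q"
    and k: "1 \<le> k"
    and saw: "\<And>v i. v \<in> V \<Longrightarrow> i \<le> k \<Longrightarrow> card (saw (V, E) v i) \<le> B"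
    and contr: "K * (\<Sum>i<k. \<rho> ^ i * B) + \<rho> ^ k * B * \<eta> powr q \<le> \<eta> powr q"
  shows "indep_poly E V z \<noteq> 0"
proof -
  define e where "e S v = weighted_dev (occ_ratio E z0 S v) (occ_ratio E z S v)" for S v
  have z0pos: "0 < z0" using z0 by simp
  have K0: "0 \<le> K" unfolding K_def by simp
  have \<rho>0: "0 \<le> \<rho>" using \<rho> m by (meson divide_nonneg_pos less_trans order_trans powr_ge_zero zero_less_one)
  have pos: "0 < occ_ratio E z0 S v" if "S \<subseteq> V" for S v
    using that V finite_subset z0pos by (blast intro: occ_ratio_pos)
  have e0: "0 \<le> e S v" if "S \<subseteq> V" for S v
    unfolding e_def by (intro weighted_dev_nonneg pos that)
  have q: "1 < q"
    by (rule Holder_exponents(2)[OF m Y_def a_def q_def])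
  have "indep_poly E S z \<noteq> 0 \<and> (\<forall>v\<in>S. e S v \<le> \<eta>)" if "finite S" "S \<subseteq> V" for S
    using that
  proof (induction S rule: finite_psubset_induct)
    case (psubset S)
    have IH: "indep_poly E T z \<noteq> 0" "\<And>v. v \<in> T \<Longrightarrow> e T v \<le> \<eta>" if "T \<subset> S" for T
      using psubset that by auto
    have step: "\<exists>f. (\<forall>u\<in>T \<inter> {u. E v u}. u \<in> f u \<and> f u \<subseteq> T - {v}) \<and>
        e T v powr q \<le> K + \<rho> * (\<Sum>u\<in>T \<inter> {u. E v u}. e (f u) u powr q)"
      if T: "T \<subseteq> S" and v: "v \<in> T" for T v
    proof -
      define A where "A = T \<inter> {u. E v u}"
      have TV: "T \<subseteq> V" using T psubset by simp
      have fin: "finite T" "finite A" using TV V finite_subset unfolding A_def by auto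
      have "\<forall>U\<subseteq>T - {v}. indep_poly E U z \<noteq> 0" using IH T v by blast
      from occ_ratio_recursion_real_complex[OF E fin(1) v z0pos this]
      obtain f where f: "\<forall>u\<in>A. u \<in> f u \<and> f u \<subseteq> T - {v}"
        and rec: "occ_ratio E z T v = z * (\<Prod>u\<in>A. 1 / (1 + occ_ratio E z (f u) u))"
          "occ_ratio E z0 T v = z0 * (\<Prod>u\<in>A. 1 / (1 + occ_ratio E z0 (f u) u))"
        unfolding A_def by blast
      have fV: "f u \<subseteq> V" if "u \<in> A" for u using f that TV by blast
      \<comment> \<open>At most \<open>D\<close> children, each with deviation at most
        \<open>\<eta>\<close>: this gives the smallness required by
        \<open>weighted_dev_step\<close>.\<close>
      have "(\<Sum>u\<in>A. e (f u) u) \<le> (\<Sum>u\<in>A. \<eta>)"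
      proof (rule sum_mono)
        fix u assume u: "u \<in> A"
        then have "f u \<subset> S" using f T v by blast
        then show "e (f u) u \<le> \<eta>" using IH(2) f u by blast
      qed
      also have "\<dots> \<le> real D * \<eta>"
        using deg[OF TV v] \<eta> unfolding A_def by simp
      finally have small: "(\<Sum>u\<in>A. e (f u) u) \<le> \<kappa>" using \<eta> by simp
      have "e T v powr q \<le> K + ((1 + \<kappa>) / (1 - \<kappa>)) powr q / m * (\<Sum>u\<in>A. e (f u) u powr q)"
        unfolding e_def K_def
        by (rule weighted_dev_step[OF m fin(2) z0 z Y_def a_def q_def \<kappa> _ rec(2,1) small[unfolded e_def]])
          (use pos fV in auto)
      also have "\<dots> \<le> K + \<rho> * (\<Sum>u\<in>A. e (f u) u powr q)"
        using \<rho> by (intro add_left_mono mult_right_mono sum_nonneg) auto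
      finally show ?thesis using f unfolding A_def by blast
    qed
    have dev: "e S v \<le> \<eta>" if v: "v \<in> S" for v
    proof -
      have base: "e T u powr q \<le> \<eta> powr q" if "T \<subset> S" "u \<in> T" for T u
        using IH(2)[OF that] e0[of T u] that psubset q by (intro powr_mono2) auto
      have sawS: "card (saw (S, E) v i) \<le> B" if "i \<le> k" for i
        using card_saw_mono[OF V psubset(3), of E v i] saw[of v i] that v psubset(3) by force
      \<comment> \<open>One step need not contract, since \<open>\<rho>\<close> times the degree may
        exceed 1; \<open>k\<close> levels together do.\<close>
      have "e S v powr q \<le> K * (\<Sum>i<k. \<rho> ^ i * card (saw (S, E) v i))
          + \<rho> ^ k * card (saw (S, E) v k) * \<eta> powr q"
        by (rule recursion_unroll[where W = "\<lambda>S v. e S v powr q" and E = E and S = S])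
          (use psubset(1) K0 \<rho>0 k step base v in auto)
      also have "\<dots> \<le> K * (\<Sum>i<k. \<rho> ^ i * B) + \<rho> ^ k * B * \<eta> powr q"
        using K0 \<rho>0 sawS by (intro add_mono mult_left_mono mult_right_mono sum_mono) auto
      finally have "e S v powr q \<le> \<eta> powr q" using contr by simp
      then show ?thesis
        using q \<eta> powr_less_mono2[of q \<eta> "e S v"] by fastforce
    qed
    have "indep_poly E S z \<noteq> 0"
    proof (cases "S = {}")
      case False
      then obtain v where v: "v \<in> S" by auto
      define x where "x = occ_ratio E z0 S v"
      define w where "w = occ_ratio E z S v"
      have x: "0 < x" unfolding x_def using pos psubset by auto
      \<comment> \<open>The weight is at most \<open>1 + x\<close>, the distance from
        \<open>x\<close> to -1, so a deviation below 1 excludes \<open>w = -1\<close>.\<close>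
      have "sqrt (x * (1 + x)) \<le> 1 + x"
        using x by (intro real_le_lsqrt) (auto simp: power2_eq_square algebra_simps)
      moreover have "cmod (w - complex_of_real x) = e S v * sqrt (x * (1 + x))"
        unfolding e_def weighted_dev_def x_def[symmetric] w_def[symmetric] using x by simp
      moreover have "e S v * sqrt (x * (1 + x)) < 1 * sqrt (x * (1 + x))"
        using dev[OF v] \<eta> x by (intro mult_strict_right_mono) auto
      ultimately have less: "cmod (w - complex_of_real x) < 1 + x" by simp
      have "1 + w \<noteq> 0"
      proof
        assume "1 + w = 0"
        then have "w - complex_of_real x = - complex_of_real (1 + x)"
          by (simp add: add_eq_0_iff)
        then have "cmod (w - complex_of_real x) = 1 + x"
          using x by (simp only: norm_minus_cancel norm_of_real)
        then show False using less by simp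
      qed
      moreover have "indep_poly E (S - {v}) z \<noteq> 0" using IH(1) v by blast
      ultimately show ?thesis
        unfolding w_def using indep_poly_delete_vertex[OF E psubset(1) v, of z] by simp
    qed simp
    then show ?case using dev by blast
  qed
  then show ?thesis using V by blast
qed

section \<open>From connective constants to uniform bounds\<close>

text \<open>An edge at \<open>v\<close> is a walk of length 1, so bounds on walk counts also bound
  the degrees in induced subgraphs.\<close>

lemma degree_le_saw_1:
  assumes S: "finite V" "S \<subseteq> V" "v \<in> S" and E: "irreflp E"
  shows "card (S \<inter> {u. E v u}) \<le> card (saw (V, E) v 1)"
proof -
  have "(\<lambda>u. [v, u]) ` (S \<inter> {u. E v u}) \<subseteq> saw (V, E) v 1"
    using S E unfolding saw_def by (auto dest: irreflpD)
  then have "card ((\<lambda>u. [v, u]) ` (S \<inter> {u. E v u})) \<le> card (saw (V, E) v 1)"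
    using S by (intro card_mono finite_saw)
  then show ?thesis by (simp add: card_image inj_on_def)
qed

lemma card_saw_le_N_le:
  assumes "finite V" "1 \<le> i" "i \<le> k"
  shows "card (saw (V, E) v i) \<le> N_le k (V, E) v"
  unfolding N_le_def using assms by (intro card_mono) (auto simp: finite_saw)

lemma N_le_le_power:
  assumes "1 \<le> k" "G \<in> H" "v \<in> fst G" "mu_k_fam k H \<le> ereal \<mu>"
  shows "real (N_le k G v) \<le> \<mu> ^ k"
proof -
  have "ereal (root k (real (N_le k G v))) \<le> mu_k k G"
    unfolding mu_k_def using assms by (intro SUP_upper)
  also have "\<dots> \<le> mu_k_fam k H"
    unfolding mu_k_fam_def using assms by (intro SUP_upper)
  also note assms(4)
  finally have "root k (real (N_le k G v)) \<le> \<mu>" by simp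
  then have "root k (real (N_le k G v)) ^ k \<le> \<mu> ^ k"
    using assms(1) by (intro power_mono) auto
  then show ?thesis using assms(1) by simp
qed

text \<open>The constants depend on \<open>H\<close> only through \<open>k\<close> and
  \<open>\<mu>\<close>, hence are uniform over the family. Centres \<open>z0 \<ge> r\<close> fall
  under the contraction argument, smaller ones under the bounded-degree argument near 0.\<close>

lemma Z_nonzero_near_interval:
  fixes H :: "'a graph set" and lam m \<mu> :: real
  assumes H: "\<forall>G\<in>H. fin_graph G"
    and \<mu>: "1 < \<mu>" "\<mu> < m" and k: "1 \<le> k" "mu_k_fam k H \<le> ereal \<mu>"
    and lam: "0 < lam" "lam \<le> lambda_c m"
  shows "\<exists>\<delta>>0. \<forall>G\<in>H. \<forall>z\<in>L_delta \<delta> {0..lam}. Z G z \<noteq> 0"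
proof -
  define Y where "Y = ln (m / (m - 1))"
  define a where "a = 1 / ((m - 1) * Y)"
  define q where "q = 2 * a / (2 * a - 1)"
  have m: "1 < m" using \<mu> by simp
  have q: "1 < q" by (rule Holder_exponents(2)[OF m Y_def a_def q_def])
  \<comment> \<open>Strictly between \<open>1 / m\<close> and \<open>1 / \<mu>\<close>: the first
    gap leaves room for the distortion by \<open>\<kappa>\<close>, the second gives
    \<open>\<rho> ^ k * B < 1\<close>.\<close>
  define \<rho> where "\<rho> = 2 / (m + \<mu>)"
  have \<rho>: "0 < \<rho>" "1 < \<rho> * m" "\<rho> * \<mu> < 1" unfolding \<rho>_def using \<mu> by (auto simp: field_simps)
  have "((\<lambda>\<kappa>. ((1 + \<kappa>) / (1 - \<kappa>)) powr q) \<longlongrightarrow> ((1 + 0) / (1 - 0)) powr q) (at_right 0)"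
    by (intro tendsto_intros) auto
  then have "\<forall>\<^sub>F \<kappa> in at_right 0. ((1 + \<kappa>) / (1 - \<kappa>)) powr q < \<rho> * m"
    using \<rho> by (intro order_tendstoD(2)) auto
  moreover have "\<forall>\<^sub>F \<kappa>::real in at_right 0. 0 < \<kappa> \<and> \<kappa> < 1"
    using eventually_at_right_real[of 0 "1::real"] by (auto elim: eventually_mono)
  ultimately have "\<forall>\<^sub>F \<kappa> in at_right 0. ((1 + \<kappa>) / (1 - \<kappa>)) powr q < \<rho> * m \<and> 0 < \<kappa> \<and> \<kappa> < 1"
    by eventually_elim auto
  then obtain \<kappa> where \<kappa>: "0 < \<kappa>" "\<kappa> < 1" and "((1 + \<kappa>) / (1 - \<kappa>)) powr q < \<rho> * m"
    using eventually_happens[of _ "at_right (0::real)"] by auto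
  then have \<kappa>\<rho>: "((1 + \<kappa>) / (1 - \<kappa>)) powr q / m \<le> \<rho>" using m by (simp add: field_simps)
  define B where "B = \<mu> ^ k"
  have B: "1 \<le> B" unfolding B_def using \<mu> by (simp add: one_le_power)
  define D where "D = nat \<lfloor>B\<rfloor>"
  have D: "real D \<le> B" unfolding D_def using B by simp
  define \<eta> where "\<eta> = \<kappa> / B"
  have \<eta>: "0 < \<eta>" "\<eta> < 1" "real D * \<eta> \<le> \<kappa>"
    unfolding \<eta>_def using \<kappa> B D by (auto simp: field_simps)
  have \<rho>B: "\<rho> ^ k * B < 1"
    unfolding B_def power_mult_distrib[symmetric] using \<rho> \<mu> k by (simp add: power_less_one_iff)
  define s where "s = (\<Sum>i<k. \<rho> ^ i * B)"
  have s: "0 < s" unfolding s_def using \<rho> B k by (intro sum_pos) (auto simp: lessThan_empty_iff)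
  \<comment> \<open>The largest \<open>K\<close> that the contraction condition allows;
    \<open>\<delta>\<close> below solves the formula for \<open>K\<close> at this value.\<close>
  define c where "c = \<eta> powr q * (1 - \<rho> ^ k * B) / s"
  have c: "0 < c" unfolding c_def using s \<rho>B \<eta> by simp
  \<comment> \<open>Chosen with \<open>2 * r * 2 ^ D = 1 / 2\<close>, so that the disc of radius
    \<open>2 * r\<close> around 0 is covered by \<open>indep_poly_nonzero_small\<close>.\<close>
  define r :: real where "r = 1 / (4 * 2 ^ D)"
  have r: "0 < r" unfolding r_def by simp
  define b where "b = (1 + 1 / \<kappa>) / (1 - \<kappa>) / r"
  have b: "0 < b" unfolding b_def using \<kappa> r by (simp add: add_pos_pos)
  define \<delta> where "\<delta> = c powr (1 / q) / b"
  have \<delta>: "0 < \<delta>" unfolding \<delta>_def using b c by simp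
  define K where "K = ((1 + 1 / \<kappa>) / (1 - \<kappa>) * (\<delta> / r)) powr q"
  have "(1 + 1 / \<kappa>) / (1 - \<kappa>) * (\<delta> / r) = b * \<delta>"
    unfolding b_def by simp
  also have "\<dots> = c powr (1 / q)"
    using b unfolding \<delta>_def by simp
  finally have "K = c" unfolding K_def using c q by (simp add: powr_powr)
  then have "K * s = \<eta> powr q * (1 - \<rho> ^ k * B)" unfolding c_def using s by simp
  then have contr: "K * (\<Sum>i<k. \<rho> ^ i * B) + \<rho> ^ k * B * \<eta> powr q \<le> \<eta> powr q"
    unfolding s_def[symmetric] by (simp add: algebra_simps)
  have "Z G z \<noteq> 0" if G: "G \<in> H" and z: "z \<in> L_delta (min \<delta> r) {0..lam}" for G z
  proof -
    define V where "V = fst G"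
    define E where "E = snd G"
    have GV: "G = (V, E)" unfolding V_def E_def by simp
    have E: "symp E" "irreflp E" and V: "finite V"
      using H G unfolding fin_graph_def E_def V_def by (auto intro!: sympI irreflpI)
    have N: "real (N_le k (V, E) v) \<le> B" if "v \<in> V" for v
      unfolding B_def using N_le_le_power[OF k(1) G _ k(2)] that unfolding GV by simp
    have saw: "card (saw (V, E) v i) \<le> B" if v: "v \<in> V" and i: "i \<le> k" for v i
    proof (cases "i = 0")
      case True
      then show ?thesis using v B by (simp add: card_saw_0)
    next
      case False
      then show ?thesis using card_saw_le_N_le[OF V _ i, of E v] N[OF v] by simp
    qed
    have deg: "card (S \<inter> {u. E v u}) \<le> D" if "S \<subseteq> V" "v \<in> S" for S v
    proof -
      have "real (card (S \<inter> {u. E v u})) \<le> B"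
        using degree_le_saw_1[OF V that E(2)] saw[of v 1] that k(1) by force
      then show ?thesis unfolding D_def by (simp add: le_nat_floor)
    qed
    obtain z0 where z0: "0 \<le> z0" "z0 \<le> lam" and zz: "cmod (z - complex_of_real z0) \<le> min \<delta> r"
      using z unfolding L_delta_def by auto
    have "indep_poly E V z \<noteq> 0"
    proof (cases "r \<le> z0")
      case True
      show ?thesis
        by (rule indep_poly_nonzero_near_positive[OF E V deg m r True _ _ Y_def a_def q_def \<kappa> \<kappa>\<rho> \<eta> K_def k(1) saw contr])
          (use z0 zz lam in auto)
    next
      case False
      have "cmod z \<le> z0 + r"
        using norm_triangle_sub[of z "complex_of_real z0"] zz z0 by simp
      also have "\<dots> \<le> 2 * r" using False by simp
      finally have "cmod z * 2 ^ D \<le> 2 * r * 2 ^ D" by (intro mult_right_mono) auto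
      also have "\<dots> = 1 / 2" unfolding r_def by simp
      finally show ?thesis by (intro indep_poly_nonzero_small[OF E V deg])
    qed
    then show ?thesis unfolding Z_eq_indep_poly V_def E_def .
  qed
  then show ?thesis using \<delta> r by (intro exI[of _ "min \<delta> r"]) auto
qed

theorem theorem1p1:
  fixes H :: "'a graph set"
  fixes lam :: real
  assumes "\<forall>G\<in>H. fin_graph G"
    and "1 < mu_inf H" and "mu_inf H < \<infinity>"
    and "0 < lam" and "lam < lambda_c (real_of_ereal (mu_inf H))"
  shows "\<exists>\<delta>>0. \<forall>G\<in>H. \<forall>z\<in>L_delta \<delta> {0..lam}. Z G z \<noteq> 0"
proof -
  define \<mu>0 where "\<mu>0 = real_of_ereal (mu_inf H)"
  have mu_inf: "mu_inf H = ereal \<mu>0"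
    unfolding \<mu>0_def using assms(2,3) by (cases "mu_inf H") auto
  have \<mu>0: "1 < \<mu>0" using assms(2) unfolding mu_inf by simp
  \<comment> \<open>Continuity turns the strict bound on \<open>lam\<close> into room for some
    \<open>m\<close> strictly above \<open>\<mu>0\<close>.\<close>
  have "(lambda_c \<longlongrightarrow> \<mu>0 powr \<mu>0 / (\<mu>0 - 1) powr (\<mu>0 + 1)) (at_right \<mu>0)"
    unfolding lambda_c_def using \<mu>0 by (intro tendsto_intros) auto
  then have "\<forall>\<^sub>F m in at_right \<mu>0. lam < lambda_c m"
    using assms(5) unfolding \<mu>0_def[symmetric] lambda_c_def[of \<mu>0] by (intro order_tendstoD(1))
  moreover have "\<forall>\<^sub>F m in at_right \<mu>0. \<mu>0 < m" by (simp add: eventually_at_right_less)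
  ultimately have "\<forall>\<^sub>F m in at_right \<mu>0. lam < lambda_c m \<and> \<mu>0 < m" by eventually_elim simp
  then obtain m where m: "lam < lambda_c m" "\<mu>0 < m"
    using eventually_happens[of _ "at_right \<mu>0"] by auto
  \<comment> \<open>Above the infimum, so some \<open>k\<close> has
    \<open>mu_k_fam k H < \<mu>\<close>; below \<open>m\<close>, so \<open>\<mu> / m < 1\<close>
    drives the contraction.\<close>
  define \<mu> where "\<mu> = (\<mu>0 + m) / 2"
  have \<mu>: "1 < \<mu>" "\<mu> < m" "\<mu>0 < \<mu>" unfolding \<mu>_def using \<mu>0 m by auto
  have "mu_inf H < ereal \<mu>" unfolding mu_inf using \<mu> by simp
  then obtain k where k: "1 \<le> k" "mu_k_fam k H < ereal \<mu>"
    unfolding mu_inf_def by (auto simp: INF_less_iff)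
  show ?thesis
    by (rule Z_nonzero_near_interval[OF assms(1) \<mu>(1,2) k(1) _ assms(4)]) (use k m in auto)
qed

end
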